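(* Let $X$ be a generalized metric space. Then $\operatorname{Fix}_{RL}(X)$ is cocomplete. Moreover, for a diagram $J\colon D\to\operatorname{Fix}_{RL}(X)$ and a weighting $W\colon D^{\mathrm{op}}\to[0,\infty]$, the colimit is calculated by $$\operatorname{colim}_W(J)=RL\bigl(\operatorname{colim}_W(\iota\circ J)\bigr),$$ where $\iota\colon\operatorname{Fix}_{RL}(X)\to\widehat X$ is the inclusion and the colimit on the right is taken in $\widehat X$.
   Context: A generalized metric space is a set $X$ with $d_X\colon X\times X\to[0,\infty]$ such that $d_X(x,x)=0$ and $d_X(x,y)+d_X(y,z)\ge d_X(x,z)$ for all $x,y,z\in X$ (no symmetry, separation or finiteness). For $a,b\in[0,\infty]$ write $b\dot{-}a:=\max(b-a,0)$ (with $\infty\dot{-}\infty=0$); $[0,\infty]$ is a generalized metric space with $d(a,b)=b\dot{-}a$. $X^{\mathrm{op}}$ has the same points and reversed metric. A short map $F\colon X\to Y$ is a function with $d_X(x,x')\ge d_Y(F(x),F(x'))$. $\widehat X$ is the space of presheaves, i.e. short maps $f\colon X^{\mathrm{op}}\to[0,\infty]$, with metric $d_{\widehat X}(f,f')=\sup_x(f'(x)\dot{-}f(x))$; $\check X$ is the space of co-presheaves, i.e. short maps $g\colon X\to[0,\infty]$, with metric $\sup_x(g'(x)\dot{-}g(x))$, and $\check X^{\mathrm{op}}$ is its opposite. Define $L\colon\widehat X\to\check X^{\mathrm{op}}$, $L(f)(y)=\sup_{x}(d_X(x,y)\dot{-}f(x))$, and $R\colon\check X^{\mathrm{op}}\to\widehat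 X$, $R(g)(x)=\sup_y(d_X(x,y)\dot{-}g(y))$. The composite $RL$ is idempotent. $\operatorname{Fix}_{RL}(X)=\{f\in\widehat X\mid RL(f)=f\}$ with the metric induced from $\widehat X$; $RL$ is regarded as a map $\widehat X\to\operatorname{Fix}_{RL}(X)$. A shape is a generalized metric space $D$, a diagram in $Z$ is a short map $J\colon D\to Z$, a weighting is a short map $W\colon D^{\mathrm{op}}\to[0,\infty]$. A colimit of $J$ weighted by $W$ is a point $c\in Z$ with $d_Z(c,z)=\sup_{e\in D}(d_Z(J(e),z)\dot{-}W(e))$ for all $z\in Z$, written $\operatorname{colim}_W(J)$; in $\widehat X$ and $\operatorname{Fix}_{RL}(X)$ a colimit is unique when it exists, and $\widehat X$ has all colimits, computed pointwise. $Z$ is cocomplete if colimits exist for all shapes, diagrams and weightings. *)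

theory Defs
  imports "HOL-Library.Extended_Nonnegative_Real" "HOL-Library.FuncSet"
begin

text \<open>The library subtraction on \<^typ>\<open>ennreal\<close> is already truncated at 0, but it satisfies
  \<open>\<infinity> - \<infinity> = \<infinity>\<close>; here \<open>\<infinity>\<close> minus \<open>\<infinity>\<close> has to be 0.\<close>

definition tdiff :: "ennreal \<Rightarrow> ennreal \<Rightarrow> ennreal" (infixl "\<ominus>" 65) where
  "b \<ominus> a = (if b = \<infinity> \<and> a = \<infinity> then 0 else b - a)"

text \<open>Spaces have an explicit carrier, so that the empty space is allowed; the values of \<open>gdist\<close>
  outside the carrier are irrelevant.\<close>

record 'a gms =
  pts :: "'a set"
  gdist :: "'a \<Rightarrow> 'a \<Rightarrow> ennreal"

definition generalized_metric_space :: "'a gms \<Rightarrow> bool" where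
  "generalized_metric_space X \<longleftrightarrow>
     (\<forall>x\<in>pts X. gdist X x x = 0) \<and>
     (\<forall>x\<in>pts X. \<forall>y\<in>pts X. \<forall>z\<in>pts X. gdist X x y + gdist X y z \<ge> gdist X x z)"

definition op_space :: "'a gms \<Rightarrow> 'a gms" where
  "op_space X = \<lparr>pts = pts X, gdist = (\<lambda>x y. gdist X y x)\<rparr>"

definition ennreal_space :: "ennreal gms" where
  "ennreal_space = \<lparr>pts = UNIV, gdist = (\<lambda>a b. b \<ominus> a)\<rparr>"

definition short_maps :: "'a gms \<Rightarrow> 'b gms \<Rightarrow> ('a \<Rightarrow> 'b) set" where
  "short_maps X Y = {F \<in> pts X \<rightarrow> pts Y.
     \<forall>x\<in>pts X. \<forall>x'\<in>pts X. gdist X x x' \<ge> gdist Y (F x) (F x')}"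

text \<open>Presheaves and co-presheaves are points of spaces and get compared by equality, so they are
  required to be \<^const>\<open>undefined\<close> outside the carrier.\<close>

definition psh :: "'a gms \<Rightarrow> ('a \<Rightarrow> ennreal) gms" where
  "psh X = \<lparr>pts = short_maps (op_space X) ennreal_space \<inter> extensional (pts X),
            gdist = (\<lambda>f f'. SUP x\<in>pts X. f' x \<ominus> f x)\<rparr>"

definition copsh :: "'a gms \<Rightarrow> ('a \<Rightarrow> ennreal) gms" where
  "copsh X = \<lparr>pts = short_maps X ennreal_space \<inter> extensional (pts X),
              gdist = (\<lambda>g g'. SUP x\<in>pts X. g' x \<ominus> g x)\<rparr>"

definition L_map :: "'a gms \<Rightarrow> ('a \<Rightarrow> ennreal) \<Rightarrow> 'a \<Rightarrow> ennreal" where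
  "L_map X f = (\<lambda>y\<in>pts X. SUP x\<in>pts X. gdist X x y \<ominus> f x)"

definition R_map :: "'a gms \<Rightarrow> ('a \<Rightarrow> ennreal) \<Rightarrow> 'a \<Rightarrow> ennreal" where
  "R_map X g = (\<lambda>x\<in>pts X. SUP y\<in>pts X. gdist X x y \<ominus> g y)"

definition RL :: "'a gms \<Rightarrow> ('a \<Rightarrow> ennreal) \<Rightarrow> 'a \<Rightarrow> ennreal" where
  "RL X = R_map X \<circ> L_map X"

definition Fix_RL :: "'a gms \<Rightarrow> ('a \<Rightarrow> ennreal) gms" where
  "Fix_RL X = \<lparr>pts = {f \<in> pts (psh X). RL X f = f}, gdist = gdist (psh X)\<rparr>"

definition Fix_incl :: "'a gms \<Rightarrow> ('a \<Rightarrow> ennreal) \<Rightarrow> ('a \<Rightarrow> ennreal)" where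
  "Fix_incl X = (\<lambda>f\<in>pts (Fix_RL X). f)"

definition weightings :: "'d gms \<Rightarrow> ('d \<Rightarrow> ennreal) set" where
  "weightings D = short_maps (op_space D) ennreal_space"

definition is_colimit ::
  "'z gms \<Rightarrow> 'd gms \<Rightarrow> ('d \<Rightarrow> ennreal) \<Rightarrow> ('d \<Rightarrow> 'z) \<Rightarrow> 'z \<Rightarrow> bool" where
  "is_colimit Z D W J c \<longleftrightarrow> c \<in> pts Z \<and>
     (\<forall>z\<in>pts Z. gdist Z c z = (SUP e\<in>pts D. gdist Z (J e) z \<ominus> W e))"

text \<open>Meaningful only where colimits exist uniquely. Colimits are unique in any space \<open>Z\<close> that is
  separated, and \<open>psh X\<close> and \<open>Fix_RL X\<close> are; see below for this and for existence in \<open>psh X\<close>.\<close>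

definition colim :: "'z gms \<Rightarrow> 'd gms \<Rightarrow> ('d \<Rightarrow> ennreal) \<Rightarrow> ('d \<Rightarrow> 'z) \<Rightarrow> 'z" where
  "colim Z D W J = (THE c. is_colimit Z D W J c)"

text \<open>HOL cannot quantify over types inside a formula, so the type from which the shapes are drawn
  is a parameter; a theorem with a free type variable \<open>'d\<close> covers all shapes.\<close>

definition cocomplete :: "'d itself \<Rightarrow> 'z gms \<Rightarrow> bool" where
  "cocomplete T Z \<longleftrightarrow>
     (\<forall>D :: 'd gms. generalized_metric_space D \<longrightarrow>
        (\<forall>J\<in>short_maps D Z. \<forall>W\<in>weightings D. \<exists>c. is_colimit Z D W J c))"

lemma tdiff_le_iff: "b \<ominus> a \<le> c \<longleftrightarrow> b \<le> a + c"
proof (cases "b = \<infinity> \<and> a = \<infinity>")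
  case False
  then show ?thesis unfolding tdiff_def
    by (auto simp: ennreal_minus_le_iff infinity_ennreal_def)
qed (auto simp: tdiff_def)

lemma tdiff_real: "x \<ge> 0 \<Longrightarrow> y \<ge> 0 \<Longrightarrow> ennreal y \<ominus> ennreal x = ennreal (max (y - x) 0)"
  by (auto simp: tdiff_def ennreal_minus max_def ennreal_neg)

lemma tdiff_infinity_left: "x < \<infinity> \<Longrightarrow> \<infinity> \<ominus> x = \<infinity>"
  by (auto simp: tdiff_def)

lemma tdiff_infinity_right: "x \<ominus> \<infinity> = 0"
  using tdiff_le_iff[of x \<infinity> 0] by (simp add: infinity_ennreal_def)

lemma eq_by_upper: "(\<And>k. (a::ennreal) \<le> k \<longleftrightarrow> b \<le> k) \<Longrightarrow> a = b"
  by (meson order.antisym order.refl)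

lemma gms_ennreal_space: "generalized_metric_space ennreal_space"
proof -
  have "c \<ominus> a \<le> (b \<ominus> a) + (c \<ominus> b)" for a b c :: ennreal
  proof -
    have "b \<le> a + (b \<ominus> a)" "c \<le> b + (c \<ominus> b)" by (simp_all flip: tdiff_le_iff)
    then have "c \<le> a + ((b \<ominus> a) + (c \<ominus> b))"
      by (metis add.assoc add_right_mono order.trans)
    then show ?thesis by (simp add: tdiff_le_iff)
  qed
  moreover have "a \<ominus> a = 0" for a using tdiff_le_iff[of a a 0] by simp
  ultimately show ?thesis by (simp add: generalized_metric_space_def ennreal_space_def)
qed

lemma psh_iff: "f \<in> pts (psh X) \<longleftrightarrow> f \<in> extensional (pts X) \<and>
   (\<forall>x\<in>pts X. \<forall>x'\<in>pts X. f x' \<le> f x + gdist X x' x)"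
  by (auto simp: psh_def short_maps_def op_space_def ennreal_space_def tdiff_le_iff)

lemma psh_dist_le: "gdist (psh X) f g \<le> k \<longleftrightarrow> (\<forall>x\<in>pts X. g x \<le> f x + k)"
  by (auto simp: psh_def SUP_le_iff tdiff_le_iff)

lemma gms_psh: "generalized_metric_space (psh X)"
proof -
  have "gdist (psh X) f h \<le> gdist (psh X) f g + gdist (psh X) g h" for f g h
    unfolding psh_dist_le
  proof
    fix x assume "x \<in> pts X"
    then have "g x \<le> f x + gdist (psh X) f g" "h x \<le> g x + gdist (psh X) g h"
      using psh_dist_le[of X f g "gdist (psh X) f g"] psh_dist_le[of X g h "gdist (psh X) g h"]
      by simp_all
    then show "h x \<le> f x + (gdist (psh X) f g + gdist (psh X) g h)"
      by (metis add.assoc add_right_mono order.trans)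
  qed
  moreover have "gdist (psh X) f f = 0" for f
    using psh_dist_le[of X f f 0] by simp
  ultimately show ?thesis by (simp add: generalized_metric_space_def)
qed

lemma psh_separated:
  assumes "f \<in> pts (psh X)" "g \<in> pts (psh X)" "gdist (psh X) f g = 0" "gdist (psh X) g f = 0"
  shows "f = g"
proof (rule extensionalityI[where A="pts X"])
  fix x assume "x \<in> pts X"
  with assms show "f x = g x" using psh_dist_le[of X f g 0] psh_dist_le[of X g f 0]
    by (auto intro: order.antisym)
qed (use assms in \<open>simp_all add: psh_iff\<close>)

lemma colimit_unique:
  assumes Z: "generalized_metric_space Z"
    and sep: "\<And>x y. x \<in> pts Z \<Longrightarrow> y \<in> pts Z \<Longrightarrow> gdist Z x y = 0 \<Longrightarrow> gdist Z y x = 0 \<Longrightarrow> x = y"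
    and c: "is_colimit Z D W J c" and c': "is_colimit Z D W J c'"
  shows "c = c'"
proof (rule sep)
  show mem: "c \<in> pts Z" "c' \<in> pts Z" using c c' by (simp_all add: is_colimit_def)
  have eq: "gdist Z c z = gdist Z c' z" if "z \<in> pts Z" for z
    using c c' that by (simp add: is_colimit_def)
  have zero: "gdist Z x x = 0" if "x \<in> pts Z" for x
    using Z that by (simp add: generalized_metric_space_def)
  show "gdist Z c c' = 0" using eq[OF mem(2)] zero[OF mem(2)] by simp
  show "gdist Z c' c = 0" using eq[OF mem(1)] zero[OF mem(1)] by simp
qed

lemma psh_colimit:
  assumes J: "J \<in> short_maps D (psh X)"
  shows "is_colimit (psh X) D W J (\<lambda>x\<in>pts X. INF e\<in>pts D. J e x + W e)" (is "is_colimit _ _ _ _ ?c")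
proof -
  have "?c \<in> pts (psh X)"
    unfolding psh_iff
  proof (intro conjI ballI)
    fix x x' assume x: "x \<in> pts X" "x' \<in> pts X"
    have "?c x' \<ominus> gdist X x' x \<le> J e x + W e" if e: "e \<in> pts D" for e
    proof -
      have "J e \<in> pts (psh X)" using J e by (auto simp: short_maps_def)
      then have "J e x' \<le> J e x + gdist X x' x" using x by (simp add: psh_iff)
      then have *: "J e x' + W e \<le> (J e x + gdist X x' x) + W e" by (rule add_right_mono)
      have "?c x' \<le> J e x' + W e" using e x by (auto intro: INF_lower)
      then have "?c x' \<le> (J e x + gdist X x' x) + W e" using * by (rule order.trans)
      then show ?thesis by (simp only: tdiff_le_iff ac_simps)
    qed
    then have "?c x' \<ominus> gdist X x' x \<le> (INF e\<in>pts D. J e x + W e)" by (rule INF_greatest)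
    then show "?c x' \<le> ?c x + gdist X x' x"
      using x by (simp add: tdiff_le_iff add.commute)
  qed simp
  moreover have "gdist (psh X) ?c z = (SUP e\<in>pts D. gdist (psh X) (J e) z \<ominus> W e)" for z
  proof (rule eq_by_upper)
    fix k
    have *: "z x \<le> ?c x + k \<longleftrightarrow> (\<forall>e\<in>pts D. z x \<le> J e x + (W e + k))" if "x \<in> pts X" for x
    proof -
      have "z x \<le> ?c x + k \<longleftrightarrow> z x \<ominus> k \<le> (INF e\<in>pts D. J e x + W e)"
        using that by (simp add: tdiff_le_iff add.commute)
      then show ?thesis by (simp add: le_INF_iff tdiff_le_iff ac_simps)
    qed
    then show "gdist (psh X) ?c z \<le> k \<longleftrightarrow> (SUP e\<in>pts D. gdist (psh X) (J e) z \<ominus> W e) \<le> k"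
      by (auto simp: psh_dist_le SUP_le_iff tdiff_le_iff)
  qed
  ultimately show ?thesis by (simp add: is_colimit_def)
qed

lemma gms_Fix_RL: "generalized_metric_space (Fix_RL X)"
  using gms_psh[of X] by (simp add: generalized_metric_space_def Fix_RL_def)

lemma Fix_RL_separated:
  assumes "f \<in> pts (Fix_RL X)" "g \<in> pts (Fix_RL X)"
    "gdist (Fix_RL X) f g = 0" "gdist (Fix_RL X) g f = 0"
  shows "f = g"
  by (rule psh_separated[where X=X]) (use assms in \<open>simp_all add: Fix_RL_def\<close>)

lemma psh_colim_eq:
  assumes "J \<in> short_maps D (psh X)"
  shows "colim (psh X) D W J = (\<lambda>x\<in>pts X. INF e\<in>pts D. J e x + W e)"
  unfolding colim_def
proof (rule the_equality)
  show c: "is_colimit (psh X) D W J (\<lambda>x\<in>pts X. INF e\<in>pts D. J e x + W e)"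
    using assms by (rule psh_colimit)
  show "c' = (\<lambda>x\<in>pts X. INF e\<in>pts D. J e x + W e)" if "is_colimit (psh X) D W J c'" for c'
    using gms_psh psh_separated that c by (rule colimit_unique)
qed

lemma Fix_RL_colim_eq:
  assumes c: "is_colimit (Fix_RL X) D W J c"
  shows "colim (Fix_RL X) D W J = c"
  unfolding colim_def
proof (rule the_equality)
  show "c' = c" if "is_colimit (Fix_RL X) D W J c'" for c'
    using gms_Fix_RL Fix_RL_separated that c by (rule colimit_unique)
qed (rule c)

end

theory Submission
  imports Defs
begin

text \<open>\<^const>\<open>L_map\<close> and \<^const>\<open>R_map\<close> form an adjunction of generalized metric spaces: both
  \<open>d(f, R g)\<close> in presheaves and \<open>d(g, L f)\<close> in co-presheaves are the least \<open>k\<close> such that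
  \<open>d(x, y) \<le> f x + g y + k\<close> for all \<open>x\<close> and \<open>y\<close> (\<open>L_R_adjunction\<close>). Consequently \<open>L R L = L\<close>,
  and for a fixed point \<open>z = R (L z)\<close> one gets
  \<open>d(R L f, z) = d(L z, L R L f) = d(L z, L f) = d(f, z)\<close>. This says that \<open>R L\<close> is a reflection
  onto its fixed points (\<open>RL_reflection\<close>), and a reflection carries colimits of the ambient
  space to colimits in the subspace: if \<open>c\<close> is a colimit in presheaves, then the distances from
  \<open>R L c\<close> to fixed points are those from \<open>c\<close>, which is the colimit formula. Presheaves have all
  colimits, so the fixed points do too.\<close>

lemma L_map_le_iff:
  "y \<in> pts X \<Longrightarrow> L_map X f y \<le> k \<longleftrightarrow> (\<forall>x\<in>pts X. gdist X x y \<le> f x + k)"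
  by (simp add: L_map_def SUP_le_iff tdiff_le_iff)

lemma R_map_le_iff:
  "x \<in> pts X \<Longrightarrow> R_map X g x \<le> k \<longleftrightarrow> (\<forall>y\<in>pts X. gdist X x y \<le> g y + k)"
  by (simp add: R_map_def SUP_le_iff tdiff_le_iff)

lemma copsh_dist_le: "gdist (copsh X) g h \<le> k \<longleftrightarrow> (\<forall>y\<in>pts X. h y \<le> g y + k)"
  by (auto simp: copsh_def SUP_le_iff tdiff_le_iff)

text \<open>Either distance is at most \<open>k\<close> iff \<open>d(x, y) \<le> f x + g y + k\<close> for all \<open>x\<close> and \<open>y\<close>, a condition
  in which presheaf and co-presheaf play symmetric roles. Comparing upper bounds avoids any case
  distinction on infinite values.\<close>

lemma L_R_adjunction: "gdist (psh X) f (R_map X g) = gdist (copsh X) g (L_map X f)"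
proof (rule eq_by_upper)
  fix k
  show "gdist (psh X) f (R_map X g) \<le> k \<longleftrightarrow> gdist (copsh X) g (L_map X f) \<le> k"
    by (auto simp: psh_dist_le copsh_dist_le R_map_le_iff L_map_le_iff ac_simps)
qed

lemma dist_le_R_map: "x \<in> pts X \<Longrightarrow> y \<in> pts X \<Longrightarrow> gdist X x y \<le> g y + R_map X g x"
  using R_map_le_iff[of x X g "R_map X g x"] by blast

lemma dist_le_L_map: "x \<in> pts X \<Longrightarrow> y \<in> pts X \<Longrightarrow> gdist X x y \<le> f x + L_map X f y"
  using L_map_le_iff[of y X f "L_map X f y"] by blast

lemma R_map_L_map_le:
  assumes "x \<in> pts X"
  shows "R_map X (L_map X f) x \<le> f x"
  using assms dist_le_L_map[of x X _ f] by (simp add: R_map_le_iff add.commute)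

text \<open>The triangle identity of the adjunction: \<open>L\<close> reverses the pointwise order, so \<open>R L f \<le> f\<close>
  gives one inequality; the other is the same unit inequality for co-presheaves, applied to \<open>L f\<close>.\<close>

lemma L_map_R_map_L_map: "L_map X (R_map X (L_map X f)) = L_map X f"
proof (rule extensionalityI[where A="pts X"])
  fix y assume y: "y \<in> pts X"
  show "L_map X (R_map X (L_map X f)) y = L_map X f y"
  proof (rule order.antisym)
    show "L_map X (R_map X (L_map X f)) y \<le> L_map X f y"
      using y dist_le_R_map[of _ X y "L_map X f"] by (simp add: L_map_le_iff add.commute)
    show "L_map X f y \<le> L_map X (R_map X (L_map X f)) y"
      unfolding L_map_le_iff[OF y]
    proof
      fix x assume x: "x \<in> pts X"
      have "gdist X x y \<le> R_map X (L_map X f) x + L_map X (R_map X (L_map X f)) y"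
        using x y by (rule dist_le_L_map)
      also have "\<dots> \<le> f x + L_map X (R_map X (L_map X f)) y"
        using R_map_L_map_le[OF x] by (rule add_right_mono)
      finally show "gdist X x y \<le> f x + L_map X (R_map X (L_map X f)) y" .
    qed
  qed
qed (simp_all add: L_map_def)

lemma R_map_in_psh:
  assumes X: "generalized_metric_space X"
  shows "R_map X g \<in> pts (psh X)"
  unfolding psh_iff
proof (intro conjI ballI)
  fix x x' assume x: "x \<in> pts X" "x' \<in> pts X"
  have "gdist X x' y \<le> g y + (R_map X g x + gdist X x' x)" if y: "y \<in> pts X" for y
  proof -
    have "gdist X x' y \<le> gdist X x' x + gdist X x y"
      using X x y by (simp add: generalized_metric_space_def)
    also have "\<dots> \<le> gdist X x' x + (g y + R_map X g x)"
      using dist_le_R_map[OF x(1) y] by (rule add_left_mono)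
    finally show ?thesis by (simp add: ac_simps)
  qed
  then show "R_map X g x' \<le> R_map X g x + gdist X x' x"
    using x by (simp add: R_map_le_iff)
qed (simp add: R_map_def)

lemma RL_in_Fix_RL:
  assumes "generalized_metric_space X"
  shows "RL X f \<in> pts (Fix_RL X)"
  using R_map_in_psh[OF assms] by (simp add: Fix_RL_def RL_def L_map_R_map_L_map)

text \<open>The universal property of a reflection: distances to a fixed point do not distinguish
  \<open>f\<close> from \<open>RL X f\<close>.\<close>

lemma RL_reflection:
  assumes "RL X z = z"
  shows "gdist (psh X) (RL X f) z = gdist (psh X) f z"
proof -
  have z: "z = R_map X (L_map X z)" using assms by (simp add: RL_def)
  have "gdist (psh X) (RL X f) z = gdist (copsh X) (L_map X z) (L_map X (RL X f))"
    by (subst z) (rule L_R_adjunction)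
  also have "\<dots> = gdist (copsh X) (L_map X z) (L_map X f)"
    by (simp add: RL_def L_map_R_map_L_map)
  also have "\<dots> = gdist (psh X) f z"
    by (subst (2) z) (rule L_R_adjunction[symmetric])
  finally show ?thesis .
qed

lemma Fix_incl_comp_short_map:
  assumes "J \<in> short_maps D (Fix_RL X)"
  shows "Fix_incl X \<circ> J \<in> short_maps D (psh X)"
  using assms by (auto simp: short_maps_def Fix_incl_def Fix_RL_def Pi_iff)

text \<open>A colimit is determined by its distances to all points; towards fixed points, \<open>R L\<close> preserves
  them, so only the test points have to be restricted.\<close>

lemma RL_colimit:
  assumes X: "generalized_metric_space X"
    and J: "J \<in> short_maps D (Fix_RL X)"
    and c: "is_colimit (psh X) D W (Fix_incl X \<circ> J) c"
  shows "is_colimit (Fix_RL X) D W J (RL X c)"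
  unfolding is_colimit_def
proof (intro conjI ballI)
  show "RL X c \<in> pts (Fix_RL X)" using X by (rule RL_in_Fix_RL)
next
  fix z assume "z \<in> pts (Fix_RL X)"
  then have z: "z \<in> pts (psh X)" "RL X z = z" by (simp_all add: Fix_RL_def)
  have incl: "Fix_incl X (J e) = J e" if "e \<in> pts D" for e
    using J that by (auto simp: short_maps_def Fix_incl_def)
  have "gdist (psh X) (RL X c) z = gdist (psh X) c z"
    using z(2) by (rule RL_reflection)
  also have "\<dots> = (SUP e\<in>pts D. gdist (psh X) (J e) z \<ominus> W e)"
    using c z(1) by (simp add: is_colimit_def incl cong: SUP_cong)
  finally show "gdist (Fix_RL X) (RL X c) z = (SUP e\<in>pts D. gdist (Fix_RL X) (J e) z \<ominus> W e)"
    by (simp add: Fix_RL_def)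
qed

theorem theorem16:
  fixes X :: "'a gms"
  assumes "generalized_metric_space X"
  shows "cocomplete TYPE('d) (Fix_RL X) \<and>
    (\<forall>D :: 'd gms. generalized_metric_space D \<longrightarrow>
      (\<forall>J\<in>short_maps D (Fix_RL X). \<forall>W\<in>weightings D.
        colim (Fix_RL X) D W J = RL X (colim (psh X) D W (Fix_incl X \<circ> J))))"
proof -
  have col: "is_colimit (Fix_RL X) D W J (RL X (colim (psh X) D W (Fix_incl X \<circ> J)))"
    if "J \<in> short_maps D (Fix_RL X)" for D :: "'d gms" and J W
  proof -
    have J: "Fix_incl X \<circ> J \<in> short_maps D (psh X)"
      using that by (rule Fix_incl_comp_short_map)
    show ?thesis
      using assms that psh_colimit[OF J, folded psh_colim_eq[OF J]] by (rule RL_colimit)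
  qed
  show ?thesis
    unfolding cocomplete_def using col Fix_RL_colim_eq[OF col] by blast
qed

end
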